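(* Let $h,w,L,\ell\ge 1$ be integers, $n=3hw$, $L\ell\le n$, and consider the image-based medium with LSB position space $\mathcal P=\{(r,c,k):0\le r<h,\ 0\le c<w,\ 0\le k<3\}$, $|\mathcal P|=n$, and a circuit $C_{\mathsf{obf}}$ of Fredkin gates applied position-wise to every position. Assume the matched-marginal condition with some per-position law $\pi$ on $\{0,1\}$. Then the position sets $(\Lambda_1,\dots,\Lambda_L)$ are statistically independent of the observed medium $(\mathbf M',\mathbf M'')$, and for every adversary $\mathcal A$ (computationally unbounded or not) in the computational privacy game, $$\mathsf{Adv}_{\mathsf{priv}}^{\mathcal A}(n,L,\ell)=\Pr[\mathcal A\text{ wins}]-\frac{L\ell}{n}=0 .$$ This holds for every law $\pi$ on $\{0,1\}$, not only the uniform one.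
   Context: Medium. An instance is an RGB image $I\in\{0,\dots,255\}^{h\times w\times 3}$. For $p=(r,c,k)\in\mathcal P$, $\mathsf{Read}(I,p)$ is the least significant bit of $I[r,c,k]$; $\mathsf{Write}(I,p,b)$ replaces that least significant bit by $b$ and leaves everything else unchanged. Gates. The Fredkin gate is $F:\{0,1\}^3\to\{0,1\}^3$, $F(0,x,y)=(0,x,y)$, $F(1,x,y)=(1,y,x)$. It is applied to three input images to produce three output images by evaluating $F$, at every position $p$ separately, on the three bits read at $p$, and writing the three results at $p$. A circuit is a finite sequence of gates in topological order, where output images of gates may serve as input images of later gates. $C_{\mathsf{obf}}$ is the wiring of this circuit; it is fixed independently of the position sets. Embedding and computation. The position sets $(\Lambda_1,\dots,\Lambda_L)$ are sampled uniformly at random among $L$-tuples of pairwise disjoint subsets of $\mathcal P$ of size $\ell$. Starting from a finite family of cover images (chosen independently of the position sets), the inputs of circuit $j$ are written into the least significant bits at the positions of $\Lambda_j$ for $j=1,\dots,L$ (one of these circuits is "real", the others are "decoys"), and all positions outside $\bigcup_j\Lambda_j$ ("fill" positions) receive fill bits. The resulting finite family of images is $\mathbf M'$. Applying the circuit $C_{\mathsf{obf}}$ uniformly to all positions yields the family $\mathbf M''$. Matched-marginal condition. The bits at the decoy positions and at the fill positions are drawn i.i.d. from the same per-position law $\pi$ as the bits embedded at the real positions, and the position sets are placed uniformly at random. That is, given the position sets, all least significant bits of $\mathbf M'$ are i.i.d. with law $\pi$. Computational privacy game. The adversary $\mathcal A$ receives $(\mathbf M',C_{\mathsf{obf}},\mathbf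 M'')$ (and may use private randomness independent of everything else) and outputs a position $p^*\in\mathcal P$. It wins if $p^*\in\bigcup_{j=1}^L\Lambda_j$. Its advantage is $\mathsf{Adv}_{\mathsf{priv}}^{\mathcal A}(n,L,\ell)=\Pr[\mathcal A\text{ wins}]-L\ell/n$. *)

theory Defs
  imports "HOL-Probability.Probability"
begin

type_synonym pos = "nat \<times> nat \<times> nat"
type_synonym image = "pos \<Rightarrow> nat"

definition positions :: "nat \<Rightarrow> nat \<Rightarrow> pos set" where
  "positions h w = {0..<h} \<times> {0..<w} \<times> {0..<3}"

lemma finite_positions [simp]: "finite (positions h w)"
  by (simp add: positions_def)

lemma card_positions: "card (positions h w) = 3 * h * w"
  by (simp add: positions_def card_cartesian_product)

definition images :: "nat \<Rightarrow> nat \<Rightarrow> image set" where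
  "images h w = positions h w \<rightarrow>\<^sub>E {0..255}"

definition Read :: "image \<Rightarrow> pos \<Rightarrow> bool" where
  "Read I p \<longleftrightarrow> odd (I p)"

definition Write :: "image \<Rightarrow> pos \<Rightarrow> bool \<Rightarrow> image" where
  "Write I p b = I(p := 2 * (I p div 2) + of_bool b)"

definition write_on :: "pos set \<Rightarrow> (pos \<Rightarrow> bool) \<Rightarrow> image \<Rightarrow> image" where
  "write_on X b I = (\<lambda>p. if p \<in> X then Write I p (b p) p else I p)"

definition fredkin :: "bool \<times> bool \<times> bool \<Rightarrow> bool \<times> bool \<times> bool" where
  "fredkin = (\<lambda>(c, x, y). if c then (c, y, x) else (c, x, y))"

text \<open>The bits computed at a position are written into the three input images, so the
  higher-order bits of each output image are those of the corresponding input image.\<close>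

definition apply_fredkin ::
  "nat \<Rightarrow> nat \<Rightarrow> image \<times> image \<times> image \<Rightarrow> image \<times> image \<times> image" where
  "apply_fredkin h w = (\<lambda>(A, B, D).
     let out = (\<lambda>p. fredkin (Read A p, Read B p, Read D p)) in
       (write_on (positions h w) (\<lambda>p. fst (out p)) A,
        write_on (positions h w) (\<lambda>p. fst (snd (out p))) B,
        write_on (positions h w) (\<lambda>p. snd (snd (out p))) D))"

text \<open>The images are numbered in order of creation: first the \<open>N\<close> input images, then the three
  outputs of each gate. A gate is the triple of the numbers of its input images. An image may be
  used by several gates.\<close>

type_synonym gate = "nat \<times> nat \<times> nat"
type_synonym circuit = "gate list"

definition wf_circuit :: "nat \<Rightarrow> circuit \<Rightarrow> bool" where
  "wf_circuit N C \<longleftrightarrow> (\<forall>g < length C. case C ! g of (a, b, d) \<Rightarrow>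
     a < N + 3 * g \<and> b < N + 3 * g \<and> d < N + 3 * g)"

definition apply_gate :: "nat \<Rightarrow> nat \<Rightarrow> gate \<Rightarrow> image list \<Rightarrow> image list" where
  "apply_gate h w = (\<lambda>(a, b, d) Is.
     case apply_fredkin h w (Is ! a, Is ! b, Is ! d) of (A, B, D) \<Rightarrow> Is @ [A, B, D])"

text \<open>The computed family consists of the output images of all gates.\<close>

definition run_circuit :: "nat \<Rightarrow> nat \<Rightarrow> circuit \<Rightarrow> image list \<Rightarrow> image list" where
  "run_circuit h w C M = drop (length M) (fold (apply_gate h w) C M)"

definition position_tuples :: "nat \<Rightarrow> nat \<Rightarrow> nat \<Rightarrow> nat \<Rightarrow> pos set list set" where
  "position_tuples h w L l = {\<Lambda>. length \<Lambda> = L \<and>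
     (\<forall>j < L. \<Lambda> ! j \<subseteq> positions h w \<and> card (\<Lambda> ! j) = l) \<and>
     (\<forall>i < L. \<forall>j < L. i \<noteq> j \<longrightarrow> \<Lambda> ! i \<inter> \<Lambda> ! j = {})}"

text \<open>\<open>inp j i p\<close> is the input bit of circuit \<open>j\<close> written into image \<open>i\<close> at \<open>p \<in> \<Lambda> ! j\<close>;
  \<open>fill i p\<close> is the bit written into image \<open>i\<close> at a position \<open>p\<close> outside all \<open>\<Lambda> ! j\<close>.\<close>

type_synonym circuit_inputs = "nat \<Rightarrow> nat \<Rightarrow> pos \<Rightarrow> bool"
type_synonym fill_bits = "nat \<Rightarrow> pos \<Rightarrow> bool"

definition embed_image ::
  "nat \<Rightarrow> nat \<Rightarrow> pos set list \<Rightarrow> circuit_inputs \<Rightarrow> fill_bits \<Rightarrow> nat \<Rightarrow> image \<Rightarrow> image" where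
  "embed_image h w \<Lambda> inp fill i I =
     write_on (positions h w - \<Union>(set \<Lambda>)) (fill i)
       (fold (\<lambda>j. write_on (\<Lambda> ! j) (inp j i)) [0..<length \<Lambda>] I)"

definition embed ::
  "nat \<Rightarrow> nat \<Rightarrow> pos set list \<Rightarrow> circuit_inputs \<Rightarrow> fill_bits \<Rightarrow> image list \<Rightarrow> image list" where
  "embed h w \<Lambda> inp fill M = map (\<lambda>i. embed_image h w \<Lambda> inp fill i (M ! i)) [0..<length M]"

definition cover_families :: "nat \<Rightarrow> nat \<Rightarrow> nat \<Rightarrow> image list set" where
  "cover_families h w N = {M. length M = N \<and> set M \<subseteq> images h w}"

text \<open>\<open>K\<close> is the law of the cover family; \<open>S \<Lambda>\<close> is the joint law of all circuit inputs (real and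
  decoy) and fill bits given the position sets \<open>\<Lambda>\<close>. The embedded medium below is the law of the
  images carrying the inputs, given the position sets.\<close>

type_synonym bit_source = "pos set list \<Rightarrow> (circuit_inputs \<times> fill_bits) pmf"

definition embedded_medium ::
  "nat \<Rightarrow> nat \<Rightarrow> image list pmf \<Rightarrow> bit_source \<Rightarrow> pos set list \<Rightarrow> image list pmf" where
  "embedded_medium h w K S \<Lambda> = do {
     cover \<leftarrow> K;
     (inp, fill) \<leftarrow> S \<Lambda>;
     return_pmf (embed h w \<Lambda> inp fill cover)
   }"

definition lsbs :: "nat \<Rightarrow> nat \<Rightarrow> nat \<Rightarrow> image list \<Rightarrow> nat \<times> pos \<Rightarrow> bool" where
  "lsbs h w N M = (\<lambda>(i, p). i < N \<and> p \<in> positions h w \<and> Read (M ! i) p)"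

text \<open>Given the position sets, all least significant bits of the embedded medium are i.i.d. with
  law \<open>\<pi>\<close>. The default \<open>False\<close> of the product law matches the value of \<^const>\<open>lsbs\<close> outside its
  index range.\<close>

definition matched_marginal ::
  "nat \<Rightarrow> nat \<Rightarrow> nat \<Rightarrow> nat \<Rightarrow> nat \<Rightarrow> image list pmf \<Rightarrow> bit_source \<Rightarrow> bool pmf \<Rightarrow> bool" where
  "matched_marginal h w L l N K S \<pi> \<longleftrightarrow> (\<forall>\<Lambda> \<in> position_tuples h w L l.
     map_pmf (lsbs h w N) (embedded_medium h w K S \<Lambda>)
       = Pi_pmf ({..<N} \<times> positions h w) False (\<lambda>_. \<pi>))"

definition view_experiment ::
  "nat \<Rightarrow> nat \<Rightarrow> nat \<Rightarrow> nat \<Rightarrow> image list pmf \<Rightarrow> bit_source \<Rightarrow> circuit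
     \<Rightarrow> (pos set list \<times> (image list \<times> image list)) pmf" where
  "view_experiment h w L l K S C = do {
     \<Lambda> \<leftarrow> pmf_of_set (position_tuples h w L l);
     M' \<leftarrow> embedded_medium h w K S \<Lambda>;
     return_pmf (\<Lambda>, (M', run_circuit h w C M'))
   }"

text \<open>Independence of two discrete random variables of possibly different types, which rules out
  \<^const>\<open>prob_space.indep_var\<close>: the \<open>\<sigma>\<close>-algebras they generate are independent.\<close>

definition indep_rvs :: "'s pmf \<Rightarrow> ('s \<Rightarrow> 'a) \<Rightarrow> ('s \<Rightarrow> 'b) \<Rightarrow> bool" where
  "indep_rvs P X Y \<longleftrightarrow> prob_space.indep_set (measure_pmf P)
     {X -` U |U. U \<in> UNIV} {Y -` V |V. V \<in> UNIV}"

text \<open>An adversary returns the law of its guess given its view; since the guess ranges over the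
  finite set of positions, this covers every kind of private randomness.\<close>

type_synonym adversary = "image list \<times> circuit \<times> image list \<Rightarrow> pos pmf"

definition is_adversary :: "nat \<Rightarrow> nat \<Rightarrow> adversary \<Rightarrow> bool" where
  "is_adversary h w A \<longleftrightarrow> (\<forall>v. set_pmf (A v) \<subseteq> positions h w)"

definition privacy_game ::
  "nat \<Rightarrow> nat \<Rightarrow> nat \<Rightarrow> nat \<Rightarrow> image list pmf \<Rightarrow> bit_source \<Rightarrow> circuit \<Rightarrow> adversary \<Rightarrow> bool pmf" where
  "privacy_game h w L l K S C A = do {
     (\<Lambda>, (M', M'')) \<leftarrow> view_experiment h w L l K S C;
     p \<leftarrow> A (M', C, M'');
     return_pmf (p \<in> \<Union>(set \<Lambda>))
   }"

definition Adv_priv ::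
  "nat \<Rightarrow> nat \<Rightarrow> nat \<Rightarrow> nat \<Rightarrow> image list pmf \<Rightarrow> bit_source \<Rightarrow> circuit \<Rightarrow> adversary \<Rightarrow> real" where
  "Adv_priv h w L l K S C A =
     pmf (privacy_game h w L l K S C A) True - real (L * l) / real (card (positions h w))"

end

theory Submission
  imports Defs
begin

text \<open>The embedding overwrites every least significant bit, so the medium is a function of the
  cover family and of the written bits; the latter are independent of the cover and, by the
  matched-marginal condition, have the same law for all position sets. Hence the view is
  independent of the position sets, and any guess \<open>p\<close> may be taken as fixed before these are
  sampled. By symmetry under transpositions of positions, the probability that the position sets
  cover \<open>p\<close> does not depend on \<open>p\<close>, so it is the average \<open>L l / n\<close>.\<close>

section \<open>Embedding into the least significant bits\<close>

text \<open>A number is determined by its parity and its half. This separates the bit layer, which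
  embedding rewrites, from the higher-order part, which it preserves.\<close>

lemma image_eqI:
  fixes I J :: image
  assumes "\<And>p. Read I p = Read J p" and "\<And>p. I p div 2 = J p div 2"
  shows "I = J"
proof
  fix p
  have "I p mod 2 = J p mod 2"
    using assms(1)[of p] by (auto simp: Read_def odd_iff_mod_2_eq_one)
  then show "I p = J p"
    using assms(2)[of p] by (metis div_mult_mod_eq)
qed

lemma Read_write_on: "Read (write_on X b I) p = (if p \<in> X then b p else Read I p)"
  by (auto simp: write_on_def Write_def Read_def)

lemma write_on_div_2: "write_on X b I p div 2 = I p div 2"
  by (auto simp: write_on_def Write_def)

text \<open>At a covered position the last write wins, whatever the starting image; hence the free
  \<open>J\<close>. Taking \<open>J = I\<close> gives the uncovered case, another \<open>J\<close>
  the independence of the cover.\<close>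

lemma Read_fold_write_on:
  "Read (fold (\<lambda>j. write_on (X j) (b j)) js I) p =
     (if p \<in> (\<Union>j\<in>set js. X j) then Read (fold (\<lambda>j. write_on (X j) (b j)) js J) p else Read I p)"
  by (induction js rule: rev_induct) (auto simp: Read_write_on)

lemma fold_write_on_div_2: "fold (\<lambda>j. write_on (X j) (b j)) js I p div 2 = I p div 2"
  by (induction js rule: rev_induct) (auto simp: write_on_div_2)

lemma embed_image_div_2: "embed_image h w \<Lambda> inp fill i I p div 2 = I p div 2"
  by (simp add: embed_image_def write_on_div_2 fold_write_on_div_2)

lemma Read_embed_image_outside:
  assumes "\<Union>(set \<Lambda>) \<subseteq> positions h w" and "p \<notin> positions h w"
  shows "Read (embed_image h w \<Lambda> inp fill i I) p = Read I p"
proof -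
  have "p \<notin> (\<Union>j\<in>set [0..<length \<Lambda>]. \<Lambda> ! j)"
    using assms by (fastforce simp: in_set_conv_nth)
  then show ?thesis
    using assms(2) by (simp add: embed_image_def Read_write_on Read_fold_write_on[of _ _ _ I p I])
qed

text \<open>Every position is overwritten, either through some set of \<Lambda> or as a fill
  position, so no bit of the cover survives.\<close>

lemma Read_embed_image_cong:
  assumes "p \<in> positions h w"
  shows "Read (embed_image h w \<Lambda> inp fill i I) p = Read (embed_image h w \<Lambda> inp fill i J) p"
proof (cases "p \<in> \<Union>(set \<Lambda>)")
  case True
  then have "p \<in> (\<Union>j\<in>set [0..<length \<Lambda>]. \<Lambda> ! j)"
    by (force simp: in_set_conv_nth)
  then show ?thesis
    using True by (simp add: embed_image_def Read_write_on Read_fold_write_on[of _ _ _ I p J])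
next
  case False
  then show ?thesis
    using assms by (simp add: embed_image_def Read_write_on)
qed

lemma lsbs_embed_cong:
  assumes "length M = N" and "length M' = N"
  shows "lsbs h w N (embed h w \<Lambda> inp fill M) = lsbs h w N (embed h w \<Lambda> inp fill M')"
proof -
  have "Read (embed h w \<Lambda> inp fill M ! i) p = Read (embed h w \<Lambda> inp fill M' ! i) p"
    if "i < N" "p \<in> positions h w" for i p
    using assms that Read_embed_image_cong[OF that(2)] by (simp add: embed_def)
  then show ?thesis
    by (auto simp: lsbs_def)
qed

text \<open>This takes no \<Lambda>: once embedding is expressed through it, the position sets can
  act only through the law of \<open>b\<close>.\<close>

definition write_lsbs :: "nat \<Rightarrow> nat \<Rightarrow> (nat \<times> pos \<Rightarrow> bool) \<Rightarrow> image list \<Rightarrow> image list" where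
  "write_lsbs h w b M =
     map (\<lambda>i. write_on (positions h w) (\<lambda>p. b (i, p)) (M ! i)) [0..<length M]"

lemma write_lsbs_lsbs_embed:
  assumes "\<Union>(set \<Lambda>) \<subseteq> positions h w"
  shows "write_lsbs h w (lsbs h w (length M) (embed h w \<Lambda> inp fill M)) M = embed h w \<Lambda> inp fill M"
  unfolding write_lsbs_def embed_def
  by (intro map_cong refl image_eqI)
    (simp_all add: lsbs_def Read_write_on write_on_div_2 embed_image_div_2
      Read_embed_image_outside[OF assms])

lemma position_tuples_Union_subset:
  "\<Lambda> \<in> position_tuples h w L l \<Longrightarrow> \<Union>(set \<Lambda>) \<subseteq> positions h w"
  by (fastforce simp: position_tuples_def in_set_conv_nth)

text \<open>The right-hand side is free of \<Lambda>. The hypothesis gives only the law of the bits;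
  their joint law with the cover follows because they depend on \<open>(inp, fill)\<close> alone,
  which is sampled independently of the cover.\<close>

lemma embedded_medium_matched_marginal:
  assumes \<Lambda>: "\<Lambda> \<in> position_tuples h w L l"
    and K: "set_pmf K \<subseteq> cover_families h w N"
    and marginal: "matched_marginal h w L l N K S \<pi>"
  shows "embedded_medium h w K S \<Lambda> =
    K \<bind> (\<lambda>M. map_pmf (\<lambda>b. write_lsbs h w b M)
      (Pi_pmf ({..<N} \<times> positions h w) False (\<lambda>_. \<pi>)))"
proof -
  \<comment> \<open>The all-zero family is an arbitrary reference of length \<open>N\<close>: by
    \<open>lsbs_embed_cong\<close> it yields the same bits as any cover.\<close>
  define bits where
    "bits = (\<lambda>(inp, fill). lsbs h w N (embed h w \<Lambda> inp fill (replicate N (\<lambda>_. 0))))"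
  have lsbs: "lsbs h w N (embed h w \<Lambda> inp fill M) = bits (inp, fill)"
    if "M \<in> set_pmf K" for M inp fill
    unfolding bits_def prod.case
    by (rule lsbs_embed_cong) (use that K in \<open>auto simp: cover_families_def\<close>)
  have embed: "embed h w \<Lambda> inp fill M = write_lsbs h w (bits (inp, fill)) M"
    if "M \<in> set_pmf K" for M inp fill
    using write_lsbs_lsbs_embed[OF position_tuples_Union_subset[OF \<Lambda>], of M inp fill]
      lsbs[OF that] that K by (auto simp: cover_families_def)
  have medium: "embedded_medium h w K S \<Lambda> =
      K \<bind> (\<lambda>M. map_pmf (\<lambda>(inp, fill). embed h w \<Lambda> inp fill M) (S \<Lambda>))"
    by (simp add: embedded_medium_def map_pmf_def case_prod_unfold)
  have "Pi_pmf ({..<N} \<times> positions h w) False (\<lambda>_. \<pi>) =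
      map_pmf (lsbs h w N) (embedded_medium h w K S \<Lambda>)"
    using marginal \<Lambda> by (simp add: matched_marginal_def)
  \<comment> \<open>The inner law is now constant in \<open>M\<close>, so averaging over
    \<open>K\<close> disappears.\<close>
  also have "\<dots> = K \<bind> (\<lambda>M. map_pmf bits (S \<Lambda>))"
    unfolding medium map_bind_pmf
    by (intro bind_pmf_cong refl) (auto simp: map_pmf_comp lsbs intro!: map_pmf_cong)
  finally have Pi: "Pi_pmf ({..<N} \<times> positions h w) False (\<lambda>_. \<pi>) = map_pmf bits (S \<Lambda>)"
    by simp
  show ?thesis
    unfolding medium Pi
    by (intro bind_pmf_cong refl) (auto simp: map_pmf_comp embed intro!: map_pmf_cong)
qed

section \<open>Random position sets\<close>

lemma finite_position_tuples: "finite (position_tuples h w L l)"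
proof (rule finite_subset)
  show "position_tuples h w L l \<subseteq> {\<Lambda>. set \<Lambda> \<subseteq> Pow (positions h w) \<and> length \<Lambda> = L}"
    by (fastforce simp: position_tuples_def in_set_conv_nth)
qed (simp add: finite_lists_length_eq)

text \<open>Without this, \<open>pmf_of_set\<close> would not be the uniform law. The witness cuts
  an enumeration of the positions into consecutive blocks of length \<open>l\<close>.\<close>

lemma position_tuples_nonempty:
  assumes "L * l \<le> card (positions h w)"
  shows "position_tuples h w L l \<noteq> {}"
proof -
  obtain f where f: "bij_betw f {0..<card (positions h w)} (positions h w)"
    using ex_bij_betw_nat_finite[OF finite_positions] by blast
  define B where "B j = {j * l..<Suc j * l}" for j
  have B: "B j \<subseteq> {0..<card (positions h w)}" if "j < L" for j
  proof -
    have "Suc j * l \<le> L * l"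
      using that by (intro mult_le_mono1) simp
    then show ?thesis
      using assms by (auto simp: B_def)
  qed
  have disj: "B i \<inter> B j = {}" if "i < j" for i j
  proof -
    have "Suc i * l \<le> j * l"
      using that by (intro mult_le_mono1) simp
    then show ?thesis
      by (auto simp: B_def)
  qed
  have inj: "inj_on f {0..<card (positions h w)}"
    using f by (simp add: bij_betw_def)
  have "f ` B i \<inter> f ` B j = {}" if "i < L" "j < L" "i \<noteq> j" for i j
    using inj_on_image_Int[OF inj B[OF that(1)] B[OF that(2)]] disj[of i j] disj[of j i] that(3)
    by (metis Int_commute image_empty linorder_neqE_nat)
  moreover have "card (f ` B j) = l" if "j < L" for j
    using card_image[OF inj_on_subset[OF inj B[OF that]]] by (simp add: B_def)
  moreover have "f ` B j \<subseteq> positions h w" if "j < L" for j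
    using B[OF that] f by (auto simp: bij_betw_def)
  ultimately have "map (\<lambda>j. f ` B j) [0..<L] \<in> position_tuples h w L l"
    by (simp add: position_tuples_def)
  then show ?thesis
    by blast
qed

lemma position_tuples_map_image:
  assumes "bij_betw \<sigma> (positions h w) (positions h w)" and "\<Lambda> \<in> position_tuples h w L l"
  shows "map ((`) \<sigma>) \<Lambda> \<in> position_tuples h w L l"
proof -
  have sub: "\<Lambda> ! j \<subseteq> positions h w" and card: "card (\<Lambda> ! j) = l" if "j < L" for j
    using assms(2) that by (auto simp: position_tuples_def)
  have inj: "inj_on \<sigma> (positions h w)" and img: "\<sigma> ` positions h w = positions h w"
    using assms(1) by (auto simp: bij_betw_def)
  have "\<sigma> ` (\<Lambda> ! i) \<inter> \<sigma> ` (\<Lambda> ! j) = {}" if "i < L" "j < L" "i \<noteq> j" for i j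
    using inj_on_image_Int[OF inj sub[OF that(1)] sub[OF that(2)]] that assms(2)
    by (simp add: position_tuples_def)
  moreover have "card (\<sigma> ` (\<Lambda> ! j)) = l" if "j < L" for j
    using card_image[OF inj_on_subset[OF inj sub[OF that]]] card[OF that] by simp
  moreover have "\<sigma> ` (\<Lambda> ! j) \<subseteq> positions h w" if "j < L" for j
    using sub[OF that] img by blast
  ultimately show ?thesis
    using assms(2) by (simp add: position_tuples_def)
qed

text \<open>Transposing \<open>p\<close> and \<open>q\<close> maps tuples covering \<open>p\<close>
  injectively to tuples covering \<open>q\<close>. Exchanging the two roles later gives
  equality.\<close>

lemma card_position_tuples_containing_le:
  assumes "p \<in> positions h w" and "q \<in> positions h w"
  shows "card {\<Lambda> \<in> position_tuples h w L l. p \<in> \<Union>(set \<Lambda>)}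
    \<le> card {\<Lambda> \<in> position_tuples h w L l. q \<in> \<Union>(set \<Lambda>)}"
proof (rule card_inj_on_le)
  let ?\<sigma> = "Transposition.transpose p q"
  have "bij_betw ?\<sigma> (positions h w) (positions h w)"
    using assms by (simp add: bij_betw_transpose_iff)
  then show "map ((`) ?\<sigma>) ` {\<Lambda> \<in> position_tuples h w L l. p \<in> \<Union>(set \<Lambda>)}
      \<subseteq> {\<Lambda> \<in> position_tuples h w L l. q \<in> \<Union>(set \<Lambda>)}"
    by (force intro: position_tuples_map_image)
  have "inj ((`) ?\<sigma>)"
    by (intro injI) (simp add: inj_image_eq_iff)
  then show "inj_on (map ((`) ?\<sigma>)) {\<Lambda> \<in> position_tuples h w L l. p \<in> \<Union>(set \<Lambda>)}"
    by (meson inj_mapI inj_on_subset subset_UNIV)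
qed (simp add: finite_position_tuples)

lemma card_Union_position_tuple:
  assumes "\<Lambda> \<in> position_tuples h w L l"
  shows "card (\<Union>(set \<Lambda>)) = L * l"
proof -
  have \<Lambda>: "length \<Lambda> = L" "\<And>j. j < L \<Longrightarrow> card (\<Lambda> ! j) = l"
    "\<And>j. j < L \<Longrightarrow> \<Lambda> ! j \<subseteq> positions h w"
    "\<And>i j. \<lbrakk>i < L; j < L; i \<noteq> j\<rbrakk> \<Longrightarrow> \<Lambda> ! i \<inter> \<Lambda> ! j = {}"
    using assms by (auto simp: position_tuples_def)
  have "\<Union>(set \<Lambda>) = (\<Union>j\<in>{..<L}. \<Lambda> ! j)"
    using \<Lambda>(1) by (auto simp: set_conv_nth)
  also have "card \<dots> = (\<Sum>j<L. card (\<Lambda> ! j))"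
    using \<Lambda> by (intro card_UN_disjoint) (auto intro: finite_subset[OF _ finite_positions])
  finally show ?thesis
    using \<Lambda>(2) by simp
qed

text \<open>Double counting of pairs of a position and a tuple covering it: by symmetry each
  position lies in equally many pairs, and each tuple lies in \<open>L * l\<close> of them.\<close>

lemma prob_position_covered:
  assumes p: "p \<in> positions h w" and le: "L * l \<le> card (positions h w)"
  shows "measure_pmf.prob (pmf_of_set (position_tuples h w L l)) {\<Lambda>. p \<in> \<Union>(set \<Lambda>)}
    = real (L * l) / real (card (positions h w))"
proof -
  let ?T = "position_tuples h w L l" and ?P = "positions h w"
  let ?c = "\<lambda>q. card {\<Lambda> \<in> ?T. q \<in> \<Union>(set \<Lambda>)}"
  have T: "finite ?T" "?T \<noteq> {}"
    using finite_position_tuples position_tuples_nonempty[OF le] by auto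
  have "card ?P * ?c p = (\<Sum>q\<in>?P. ?c q)"
  proof -
    have "?c q = ?c p" if "q \<in> ?P" for q
      using that p by (intro le_antisym card_position_tuples_containing_le)
    then show ?thesis
      by simp
  qed
  also have "\<dots> = (\<Sum>q\<in>?P. \<Sum>\<Lambda>\<in>?T. of_bool (q \<in> \<Union>(set \<Lambda>)))"
    using T(1) by (simp add: sum.If_cases Int_def of_bool_def)
  also have "\<dots> = (\<Sum>\<Lambda>\<in>?T. \<Sum>q\<in>?P. of_bool (q \<in> \<Union>(set \<Lambda>)))"
    by (rule sum.swap)
  also have "\<dots> = (\<Sum>\<Lambda>\<in>?T. L * l)"
  proof (intro sum.cong refl)
    fix \<Lambda> assume \<Lambda>: "\<Lambda> \<in> ?T"
    have "(\<Sum>q\<in>?P. of_bool (q \<in> \<Union>(set \<Lambda>))) = card (?P \<inter> \<Union>(set \<Lambda>))"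
      by (simp add: sum.If_cases of_bool_def Int_def)
    also have "?P \<inter> \<Union>(set \<Lambda>) = \<Union>(set \<Lambda>)"
      using position_tuples_Union_subset[OF \<Lambda>] by blast
    finally show "(\<Sum>q\<in>?P. of_bool (q \<in> \<Union>(set \<Lambda>))) = L * l"
      using card_Union_position_tuple[OF \<Lambda>] by simp
  qed
  finally have "card ?P * ?c p = card ?T * (L * l)"
    by simp
  then have "real (?c p) * real (card ?P) = real (L * l) * real (card ?T)"
    unfolding of_nat_mult[symmetric] by (simp only: mult.commute)
  moreover have "card ?P \<noteq> 0" "card ?T \<noteq> 0"
    using p T by auto
  ultimately have "real (?c p) / real (card ?T) = real (L * l) / real (card ?P)"
    by (subst frac_eq_eq) (simp_all del: of_nat_mult)
  moreover have "?T \<inter> {\<Lambda>. p \<in> \<Union>(set \<Lambda>)} = {\<Lambda> \<in> ?T. p \<in> \<Union>(set \<Lambda>)}"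
    by blast
  ultimately show ?thesis
    using T by (simp add: measure_pmf_of_set)
qed

section \<open>The privacy game\<close>

text \<open>A conditional law that is constant in \<Lambda> makes the joint law a product; the
  circuit output is a function of the medium and preserves this.\<close>

lemma view_experiment_eq_pair_pmf:
  assumes "L * l \<le> card (positions h w)"
    and "\<And>\<Lambda>. \<Lambda> \<in> position_tuples h w L l \<Longrightarrow> embedded_medium h w K S \<Lambda> = Q"
  shows "view_experiment h w L l K S C =
    pair_pmf (pmf_of_set (position_tuples h w L l)) (map_pmf (\<lambda>M. (M, run_circuit h w C M)) Q)"
proof -
  have "view_experiment h w L l K S C = pmf_of_set (position_tuples h w L l) \<bind>
      (\<lambda>\<Lambda>. Q \<bind> (\<lambda>M. return_pmf (\<Lambda>, M, run_circuit h w C M)))"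
    unfolding view_experiment_def
    using finite_position_tuples position_tuples_nonempty[OF assms(1)] assms(2)
    by (intro bind_pmf_cong) auto
  then show ?thesis
    by (simp add: pair_pmf_def bind_map_pmf)
qed

lemma measure_pair_pmf_Times:
  "measure_pmf.prob (pair_pmf p q) (A \<times> B) = measure_pmf.prob p A * measure_pmf.prob q B"
proof -
  \<comment> \<open>Cutting down to the supports changes no probability and makes both sets
    countable, as \<open>measure_pmf_prob_product\<close> requires.\<close>
  have "measure_pmf.prob (pair_pmf p q) (A \<times> B)
      = measure_pmf.prob (pair_pmf p q) ((A \<inter> set_pmf p) \<times> (B \<inter> set_pmf q))"
    by (rule measure_prob_cong_0) (auto simp: pmf_eq_0_set_pmf)
  also have "\<dots> = measure_pmf.prob p (A \<inter> set_pmf p) * measure_pmf.prob q (B \<inter> set_pmf q)"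
    by (rule measure_pmf_prob_product) (auto intro: countable_Int2)
  finally show ?thesis
    by (simp add: measure_Int_set_pmf)
qed

lemma indep_rvs_pair_pmf: "indep_rvs (pair_pmf p q) fst snd"
proof -
  have "measure_pmf.prob (pair_pmf p q) (fst -` U \<inter> snd -` V) =
      measure_pmf.prob (pair_pmf p q) (fst -` U) * measure_pmf.prob (pair_pmf p q) (snd -` V)"
    for U V
  proof -
    have "fst -` U \<inter> snd -` V = U \<times> V"
      by auto
    moreover have "measure_pmf.prob (pair_pmf p q) (fst -` U) = measure_pmf.prob p U"
      by (metis map_fst_pair_pmf measure_map_pmf)
    moreover have "measure_pmf.prob (pair_pmf p q) (snd -` V) = measure_pmf.prob q V"
      by (metis map_snd_pair_pmf measure_map_pmf)
    ultimately show ?thesis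
      by (simp add: measure_pair_pmf_Times)
  qed
  then show ?thesis
    by (auto simp: indep_rvs_def prob_space.indep_sets2_eq[OF prob_space_measure_pmf])
qed

lemma pmf_privacy_game_True:
  assumes le: "L * l \<le> card (positions h w)" and A: "is_adversary h w A"
    and view: "view_experiment h w L l K S C = pair_pmf (pmf_of_set (position_tuples h w L l)) V"
  shows "pmf (privacy_game h w L l K S C A) True = real (L * l) / real (card (positions h w))"
proof -
  let ?U = "pmf_of_set (position_tuples h w L l)"
  let ?r = "real (L * l) / real (card (positions h w))"
  \<comment> \<open>The law of the guess, averaged over the view. It does not involve \<Lambda>, so
    the guess can be drawn before the position sets.\<close>
  let ?G = "V \<bind> (\<lambda>(M', M''). A (M', C, M''))"
  have "privacy_game h w L l K S C A =
      ?U \<bind> (\<lambda>\<Lambda>. V \<bind> (\<lambda>(M', M''). A (M', C, M'') \<bind> (\<lambda>p. return_pmf (p \<in> \<Union>(set \<Lambda>)))))"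
    by (simp add: privacy_game_def view pair_pmf_def bind_assoc_pmf bind_return_pmf
        case_prod_unfold)
  also have "\<dots> = ?U \<bind> (\<lambda>\<Lambda>. ?G \<bind> (\<lambda>p. return_pmf (p \<in> \<Union>(set \<Lambda>))))"
    by (simp add: bind_assoc_pmf case_prod_unfold)
  also have "\<dots> = ?G \<bind> (\<lambda>p. map_pmf (\<lambda>\<Lambda>. p \<in> \<Union>(set \<Lambda>)) ?U)"
    by (subst bind_commute_pmf) (simp add: map_pmf_def)
  finally have "pmf (privacy_game h w L l K S C A) True =
      (\<integral>p. pmf (map_pmf (\<lambda>\<Lambda>. p \<in> \<Union>(set \<Lambda>)) ?U) True \<partial>?G)"
    by (simp add: pmf_bind)
  also have "\<dots> = (\<integral>p. ?r \<partial>?G)"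
  \<comment> \<open>The integrand equals \<open>?r\<close> only at actual positions; the guess lies
    there almost surely by \<open>is_adversary\<close>.\<close>
  proof (intro integral_cong_AE)
    have "set_pmf ?G \<subseteq> positions h w"
      using A by (auto simp: is_adversary_def)
    then show "AE p in ?G. pmf (map_pmf (\<lambda>\<Lambda>. p \<in> \<Union>(set \<Lambda>)) ?U) True = ?r"
      using prob_position_covered[OF _ le]
      by (auto simp: AE_measure_pmf_iff pmf_map vimage_def)
  qed simp_all
  finally show ?thesis
    by simp
qed

theorem corollary1:
  fixes h w L l n N :: nat
    and C :: circuit
    and K :: "image list pmf"
    and S :: bit_source
    and \<pi> :: "bool pmf"
  assumes "h \<ge> 1" and "w \<ge> 1" and "L \<ge> 1" and "l \<ge> 1"
    and "n = 3 * h * w" and "L * l \<le> n"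
    and "wf_circuit N C"
    and "set_pmf K \<subseteq> cover_families h w N"
    and "matched_marginal h w L l N K S \<pi>"
  shows "indep_rvs (view_experiment h w L l K S C) fst snd
       \<and> (\<forall>A. is_adversary h w A \<longrightarrow>
            Adv_priv h w L l K S C A
              = pmf (privacy_game h w L l K S C A) True - real (L * l) / real n
          \<and> Adv_priv h w L l K S C A = 0)"
proof -
  have n: "card (positions h w) = n" and le: "L * l \<le> card (positions h w)"
    using assms(5,6) by (simp_all add: card_positions)
  \<comment> \<open>Here \<open>Q\<close> becomes the \<Lambda>-free law of the medium, so both
    claims reduce to facts about a product law.\<close>
  note view = view_experiment_eq_pair_pmf[OF le
      embedded_medium_matched_marginal[OF _ assms(8,9)], of C]
  show ?thesis
    unfolding Adv_priv_def n[symmetric]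
    using pmf_privacy_game_True[OF le _ view] indep_rvs_pair_pmf
    by (auto simp: view)
qed

end
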